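(* Let $\Phi(p)=\tfrac12\phi^2(p)$ and define for $p\in\mathbb{R}^d\setminus\{0\}$ $$H(p)=\alpha(p)\left[\mathrm{Id}+\frac{w(p)\otimes(\frac{p}{|p|}-w(p))-\frac{p}{|p|}\otimes(w(p)+|w(p)|^2\frac{p}{|p|})}{1+|w(p)|^2}\right],$$ with $$\alpha(p)=\mathfrak{m}(p)|p|\phi(p)>0\quad\text{and}\quad w(p)=\frac{|p|}{\phi(p)}\left(\mathrm{Id}-\frac{p\otimes p}{|p|^2}\right)\phi'(p)=\frac{|p|}{\phi(p)}\phi'(p)-\frac{p}{|p|}.$$ If $x:I\times[0,T]\to\mathbb{R}^d$, with $x_\rho\neq0$, is a (classical) solution of $$H(x_\rho)x_t=[\Phi'(x_\rho)]_\rho ,$$ then $x$ is a solution to anisotropic curve shortening flow, i.e. $$\mathfrak{m}(\tau)\,P\,x_t=\frac{[\phi'(\tau)]_\rho}{|x_\rho|},\qquad \tau=\frac{x_\rho}{|x_\rho|},\quad P=\mathrm{Id}-\tau\otimes\tau.$$ Furthermore, $p\mapsto H(p)$ belongs to $C^3(\mathbb{R}^d\setminus\{0\},\mathbb{R}^{d\times d})$ and $H(p)$ is positive definite with $$H(p)z\cdot z\ge\frac{\alpha(p)}{1+|w(p)|^2}|z|^2\qquad\forall\ p\in\mathbb{R}^d\setminus\{0\},\ z\in\mathbb{R}^d.$$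
   Context: Let $d\ge2$. The anisotropy $\phi\in C^0(\mathbb{R}^d,\mathbb{R}_{\ge0})\cap C^4(\mathbb{R}^d\setminus\{0\},\mathbb{R}_{>0})$ satisfies $\phi(\lambda p)=|\lambda|\phi(p)$ for all $p\in\mathbb{R}^d$, $\lambda\in\mathbb{R}$, and the strict convexity condition $\phi''(p)q\cdot q>0$ for all $p,q\in\mathbb{R}^d$ with $|p|=|q|=1$, $p\cdot q=0$; $\phi'$ and $\phi''$ denote gradient and Hessian. The mobility $\mathfrak{m}:\mathbb{S}^{d-1}\to\mathbb{R}_{>0}$ is extended $0$-homogeneously to $\mathbb{R}^d\setminus\{0\}$ and satisfies $\mathfrak{m}\in C^3(\mathbb{R}^d\setminus\{0\})$. $I=\mathbb{R}/\mathbb{Z}$ is the periodic unit interval, $T>0$, subscripts $\rho$ and $t$ denote partial derivatives in $\rho\in I$ and $t$, and $a\otimes b=ab^T$. Positive definite (for the not necessarily symmetric matrix $H(p)$) means $H(p)z\cdot z>0$ for all $z\in\mathbb{R}^d\setminus\{0\}$. Equations for $x$ are understood pointwise on $I\times(0,T]$, where a classical solution has continuous derivatives $x_t,x_\rho,x_{\rho\rho}$. *)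

theory Defs
  imports "HOL-Analysis.Analysis"
begin

text \<open>Meaningful for open \<open>S\<close>: \<open>f\<close> is differentiable on \<open>S\<close> and all its directional
  derivatives are of class \<open>C\<^sup>k\<close> again.\<close>
primrec Ck_on :: "nat \<Rightarrow> ('a::real_normed_vector \<Rightarrow> 'b::real_normed_vector) \<Rightarrow> 'a set \<Rightarrow> bool" where
  "Ck_on 0 f S \<longleftrightarrow> continuous_on S f"
| "Ck_on (Suc k) f S \<longleftrightarrow>
    (\<forall>p\<in>S. f differentiable (at p)) \<and>
    (\<forall>v. Ck_on k (\<lambda>p. frechet_derivative f (at p) v) S)"

definition grad :: "(real^'n \<Rightarrow> real) \<Rightarrow> real^'n \<Rightarrow> real^'n" where
  "grad f p = (\<chi> i. frechet_derivative f (at p) (axis i 1))"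

definition hessian :: "(real^'n \<Rightarrow> real) \<Rightarrow> real^'n \<Rightarrow> real^'n^'n" where
  "hessian f p = jacobian (grad f) (at p)"

definition outer :: "real^'n \<Rightarrow> real^'n \<Rightarrow> real^'n^'n" where
  "outer a b = (\<chi> i j. a $ i * b $ j)"

text \<open>Matrices are not required to be symmetric.\<close>
definition pos_definite :: "real^'n^'n \<Rightarrow> bool" where
  "pos_definite A \<longleftrightarrow> (\<forall>z. z \<noteq> 0 \<longrightarrow> (A *v z) \<bullet> z > 0)"

definition anisotropy :: "(real^'n \<Rightarrow> real) \<Rightarrow> bool" where
  "anisotropy \<phi> \<longleftrightarrow>
    continuous_on UNIV \<phi> \<and> (\<forall>p. \<phi> p \<ge> 0) \<and>
    Ck_on 4 \<phi> (- {0}) \<and> (\<forall>p. p \<noteq> 0 \<longrightarrow> \<phi> p > 0) \<and>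
    (\<forall>p c. \<phi> (c *\<^sub>R p) = \<bar>c\<bar> * \<phi> p) \<and>
    (\<forall>p q. norm p = 1 \<and> norm q = 1 \<and> p \<bullet> q = 0 \<longrightarrow> (hessian \<phi> p *v q) \<bullet> q > 0)"

text \<open>A mobility is a positive function on the unit sphere; it is represented by its
  (positively) \<open>0\<close>-homogeneous extension to \<open>- {0}\<close>. The value at \<open>0\<close> is irrelevant.\<close>
definition mobility :: "(real^'n \<Rightarrow> real) \<Rightarrow> bool" where
  "mobility m \<longleftrightarrow>
    (\<forall>p. norm p = 1 \<longrightarrow> m p > 0) \<and>
    (\<forall>p c. p \<noteq> 0 \<and> c > 0 \<longrightarrow> m (c *\<^sub>R p) = m p) \<and>
    Ck_on 3 m (- {0})"

definition Phi :: "(real^'n \<Rightarrow> real) \<Rightarrow> real^'n \<Rightarrow> real" where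
  "Phi \<phi> p = 1/2 * (\<phi> p)\<^sup>2"

definition alpha :: "(real^'n \<Rightarrow> real) \<Rightarrow> (real^'n \<Rightarrow> real) \<Rightarrow> real^'n \<Rightarrow> real" where
  "alpha \<phi> m p = m p * norm p * \<phi> p"

definition wvec :: "(real^'n \<Rightarrow> real) \<Rightarrow> real^'n \<Rightarrow> real^'n" where
  "wvec \<phi> p = (norm p / \<phi> p) *\<^sub>R ((mat 1 - outer p p /\<^sub>R (norm p)\<^sup>2) *v grad \<phi> p)"

definition Hmat :: "(real^'n \<Rightarrow> real) \<Rightarrow> (real^'n \<Rightarrow> real) \<Rightarrow> real^'n \<Rightarrow> real^'n^'n" where
  "Hmat \<phi> m p =
    (let w = wvec \<phi> p; u = p /\<^sub>R norm p in
      alpha \<phi> m p *\<^sub>R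
        (mat 1 + (outer w (u - w) - outer u (w + (norm w)\<^sup>2 *\<^sub>R u)) /\<^sub>R (1 + (norm w)\<^sup>2)))"

text \<open>Maps \<open>I \<times> [0,T] \<rightarrow> \<real>\<^sup>d\<close> with \<open>I = \<real>/\<int>\<close> are functions \<open>x \<rho> t\<close>
  that are \<open>1\<close>-periodic in \<open>\<rho>\<close>. The time derivative is one-sided at \<open>t = T\<close>.\<close>
definition d_rho :: "(real \<Rightarrow> real \<Rightarrow> real^'n) \<Rightarrow> real \<Rightarrow> real \<Rightarrow> real^'n" where
  "d_rho x \<rho> t = vector_derivative (\<lambda>r. x r t) (at \<rho>)"

definition d_time :: "real \<Rightarrow> (real \<Rightarrow> real \<Rightarrow> real^'n) \<Rightarrow> real \<Rightarrow> real \<Rightarrow> real^'n" where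
  "d_time T x \<rho> t = vector_derivative (\<lambda>s. x \<rho> s) (at t within {0..T})"

definition classical_curve :: "real \<Rightarrow> (real \<Rightarrow> real \<Rightarrow> real^'n) \<Rightarrow> bool" where
  "classical_curve T x \<longleftrightarrow>
    (\<forall>\<rho>. \<forall>t\<in>{0..T}. x (\<rho> + 1) t = x \<rho> t) \<and>
    (\<forall>\<rho>. \<forall>t\<in>{0<..T}.
      (\<lambda>s. x \<rho> s) differentiable (at t within {0..T}) \<and>
      (\<lambda>r. x r t) differentiable (at \<rho>) \<and>
      (\<lambda>r. d_rho x r t) differentiable (at \<rho>)) \<and>
    continuous_on (UNIV \<times> {0<..T}) (\<lambda>(\<rho>, t). d_time T x \<rho> t) \<and>
    continuous_on (UNIV \<times> {0<..T}) (\<lambda>(\<rho>, t). d_rho x \<rho> t) \<and>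
    continuous_on (UNIV \<times> {0<..T}) (\<lambda>(\<rho>, t). d_rho (d_rho x) \<rho> t)"

definition immersed :: "real \<Rightarrow> (real \<Rightarrow> real \<Rightarrow> real^'n) \<Rightarrow> bool" where
  "immersed T x \<longleftrightarrow> (\<forall>\<rho>. \<forall>t\<in>{0<..T}. d_rho x \<rho> t \<noteq> 0)"

text \<open>Differentiability of \<open>\<rho> \<mapsto> \<Phi>'(x\<^sub>\<rho>)\<close> follows from that of \<open>x\<^sub>\<rho>\<close>
  since \<open>\<Phi>'\<close> is \<open>C\<^sup>1\<close> away from \<open>0\<close>.\<close>
definition solves_H_system ::
    "(real^'n \<Rightarrow> real) \<Rightarrow> (real^'n \<Rightarrow> real) \<Rightarrow> real \<Rightarrow> (real \<Rightarrow> real \<Rightarrow> real^'n) \<Rightarrow> bool" where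
  "solves_H_system \<phi> m T x \<longleftrightarrow>
    classical_curve T x \<and> immersed T x \<and>
    (\<forall>\<rho>. \<forall>t\<in>{0<..T}.
      Hmat \<phi> m (d_rho x \<rho> t) *v d_time T x \<rho> t =
        d_rho (\<lambda>r s. grad (Phi \<phi>) (d_rho x r s)) \<rho> t)"

definition tangent :: "(real \<Rightarrow> real \<Rightarrow> real^'n) \<Rightarrow> real \<Rightarrow> real \<Rightarrow> real^'n" where
  "tangent x \<rho> t = d_rho x \<rho> t /\<^sub>R norm (d_rho x \<rho> t)"

definition solves_ACSF ::
    "(real^'n \<Rightarrow> real) \<Rightarrow> (real^'n \<Rightarrow> real) \<Rightarrow> real \<Rightarrow> (real \<Rightarrow> real \<Rightarrow> real^'n) \<Rightarrow> bool" where
  "solves_ACSF \<phi> m T x \<longleftrightarrow>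
    classical_curve T x \<and> immersed T x \<and>
    (\<forall>\<rho>. \<forall>t\<in>{0<..T}.
      (\<lambda>r. grad \<phi> (tangent x r t)) differentiable (at \<rho>) \<and>
      m (tangent x \<rho> t) *\<^sub>R
          ((mat 1 - outer (tangent x \<rho> t) (tangent x \<rho> t)) *v d_time T x \<rho> t) =
        d_rho (\<lambda>r s. grad \<phi> (tangent x r s)) \<rho> t /\<^sub>R norm (d_rho x \<rho> t))"

end

theory Submission
  imports Defs
begin

text \<open>Write \<open>u = p / |p|\<close>. Differentiating \<open>\<phi>(c p) = |c| \<phi>(p)\<close> once in \<open>c\<close> and once in \<open>p\<close>
  gives Euler's identity \<open>\<phi>'(p) \<bullet> p = \<phi>(p)\<close> and the homogeneity \<open>\<phi>'(c p) = \<phi>'(p)\<close> for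
  \<open>c > 0\<close>. The first one says that \<open>w \<bottom> u\<close> and \<open>\<phi>'(p) = (\<phi>(p) / |p|) (u + w)\<close>, so that
  \<open>\<phi>'(p)\<close> spans the line of \<open>u + w\<close>.

  Put \<open>a = u \<bullet> z\<close>, \<open>b = w \<bullet> z\<close> and \<open>D = 1 + |w|\<^sup>2\<close>. The mixed terms of \<open>H(p)\<close> are skew, so that
  \<open>H(p)z \<bullet> z = \<alpha> (|z|\<^sup>2 - (b\<^sup>2 + |w|\<^sup>2 a\<^sup>2) / D)\<close>, and as \<open>b\<close> only sees the part of \<open>z\<close> normal
  to \<open>u\<close>, Cauchy--Schwarz bounds the bracket below by \<open>|z|\<^sup>2 / D\<close>. The matrix is built such that
  \<open>H(p)z = \<alpha> ((z - a u) + ((a - b) / D) (u + w))\<close>: up to a multiple of \<open>u + w\<close> it is the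
  normal projection.

  On the other side of the equation \<open>[\<Phi>'(x\<^sub>\<rho>)]\<^sub>\<rho> = [\<phi>(x\<^sub>\<rho>)]\<^sub>\<rho> \<phi>'(x\<^sub>\<rho>) + \<phi>(x\<^sub>\<rho>) [\<phi>'(x\<^sub>\<rho>)]\<^sub>\<rho>\<close>, where
  the first summand is a multiple of \<open>u + w\<close> and \<open>[\<phi>'(x\<^sub>\<rho>)]\<^sub>\<rho>\<close> is normal to \<open>x\<^sub>\<rho>\<close>, as one
  sees by differentiating Euler's identity along the curve. Both sides are therefore
  decomposed into a vector normal to \<open>u\<close> and a multiple of \<open>u + w\<close>. This decomposition is
  unique because \<open>w \<bottom> u\<close>, and comparing the normal vectors gives
  \<open>\<alpha> P x\<^sub>t = \<phi>(x\<^sub>\<rho>) [\<phi>'(x\<^sub>\<rho>)]\<^sub>\<rho>\<close>, which is anisotropic curve shortening flow after division by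
  \<open>|x\<^sub>\<rho>| \<phi>(x\<^sub>\<rho>)\<close>.

  The matrix \<open>H\<close> is of class \<open>C\<^sup>3\<close> because it is built from the \<open>C\<^sup>3\<close> maps \<open>\<phi>\<close>, \<open>\<phi>'\<close>, \<open>m\<close> and
  the norm by bounded bilinear products, sums and reciprocals of non-vanishing functions.\<close>

section \<open>Calculus of \<open>C\<^sup>k\<close> maps\<close>

lemma Ck_on_cong:
  assumes "open S" "\<And>p. p \<in> S \<Longrightarrow> f p = g p" "Ck_on k f S"
  shows "Ck_on k g S"
  using assms(2,3)
proof (induction k arbitrary: f g)
  case 0
  then show ?case by (simp cong: continuous_on_cong)
next
  case (Suc k)
  have deriv: "(g has_derivative frechet_derivative f (at p)) (at p)" if "p \<in> S" for p
    using Suc.prems that assms(1)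
    by (auto simp: frechet_derivative_works intro: has_derivative_transform_within_open)
  then have eq: "frechet_derivative f (at p) v = frechet_derivative g (at p) v" if "p \<in> S" for p v
    using that frechet_derivative_at by metis
  have "Ck_on k (\<lambda>p. frechet_derivative g (at p) v) S" for v
    using Suc.prems(2) by (intro Suc.IH[OF eq]) auto
  then show ?case
    using deriv by (auto intro: differentiableI)
qed

text \<open>The recursive step of \<open>Ck_on\<close>, freed from the choice operator: any explicit formula for
  the derivative will do.\<close>
lemma Ck_on_SucI:
  assumes "open S" "\<And>p. p \<in> S \<Longrightarrow> (f has_derivative f' p) (at p)"
    and "\<And>v. Ck_on k (\<lambda>p. f' p v) S"
  shows "Ck_on (Suc k) f S"
proof -
  have eq: "f' p v = frechet_derivative f (at p) v" if "p \<in> S" for p v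
    using assms(2)[OF that] frechet_derivative_at by metis
  have "Ck_on k (\<lambda>p. frechet_derivative f (at p) v) S" for v
    by (rule Ck_on_cong[OF assms(1) eq assms(3)])
  then show ?thesis
    using assms(2) by (auto intro: differentiableI)
qed

lemma Ck_on_SucD:
  assumes "Ck_on (Suc k) f S"
  shows "p \<in> S \<Longrightarrow> (f has_derivative frechet_derivative f (at p)) (at p)"
    and "Ck_on k (\<lambda>p. frechet_derivative f (at p) v) S"
  using assms by (auto simp: frechet_derivative_works)

lemma Ck_on_Suc_imp: "Ck_on (Suc k) f S \<Longrightarrow> Ck_on k f S"
proof (induction k arbitrary: f)
  case 0
  then show ?case
    by (auto intro!: continuous_at_imp_continuous_on differentiable_imp_continuous_within)
next
  case (Suc k)
  have "Ck_on k (\<lambda>p. frechet_derivative f (at p) v) S" for v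
    using Suc.IH Suc.prems by (simp only: Ck_on.simps(2)[of "Suc k"])
  with Suc.prems show ?case by simp
qed

lemma Ck_on_const: "open S \<Longrightarrow> Ck_on k (\<lambda>_. c) S"
proof (induction k arbitrary: c)
  case (Suc k)
  then show ?case by (intro Ck_on_SucI[where f' = "\<lambda>_ _. 0"]) auto
qed simp

lemma Ck_on_ident: "open S \<Longrightarrow> Ck_on k (\<lambda>p. p) S"
  by (cases k) (auto intro!: Ck_on_SucI[where f' = "\<lambda>_ v. v"] Ck_on_const)

lemma Ck_on_add:
  assumes "open S" "Ck_on k f S" "Ck_on k g S"
  shows "Ck_on k (\<lambda>p. f p + g p) S"
  using assms(2,3)
proof (induction k arbitrary: f g)
  case (Suc k)
  note f = Suc.prems(1) and g = Suc.prems(2)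
  show ?case
  proof (rule Ck_on_SucI[OF assms(1)])
    show "((\<lambda>p. f p + g p) has_derivative
        (\<lambda>v. frechet_derivative f (at p) v + frechet_derivative g (at p) v)) (at p)"
      if "p \<in> S" for p
      by (intro has_derivative_add Ck_on_SucD(1)[OF f that] Ck_on_SucD(1)[OF g that])
    show "Ck_on k (\<lambda>p. frechet_derivative f (at p) v + frechet_derivative g (at p) v) S" for v
      by (intro Suc.IH Ck_on_SucD(2)[OF f] Ck_on_SucD(2)[OF g])
  qed
qed (simp add: continuous_intros)

lemma Ck_on_sum:
  assumes "open S" "finite A" "\<And>i. i \<in> A \<Longrightarrow> Ck_on k (f i) S"
  shows "Ck_on k (\<lambda>p. \<Sum>i\<in>A. f i p) S"
  using assms(2,3)
  by (induction A rule: finite_induct) (auto intro!: Ck_on_add Ck_on_const assms(1))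

text \<open>One product rule serves the scalar, inner and outer products at once.\<close>
lemma Ck_on_bilinear:
  assumes "bounded_bilinear h" "open S" "Ck_on k f S" "Ck_on k g S"
  shows "Ck_on k (\<lambda>p. h (f p) (g p)) S"
  using assms(3,4)
proof (induction k arbitrary: f g)
  case 0
  then show ?case by (simp add: bounded_bilinear.continuous_on[OF assms(1)])
next
  case (Suc k)
  note f = Suc.prems(1) and g = Suc.prems(2)
  show ?case
  proof (rule Ck_on_SucI[OF assms(2)])
    show "((\<lambda>p. h (f p) (g p)) has_derivative
        (\<lambda>v. h (f p) (frechet_derivative g (at p) v) + h (frechet_derivative f (at p) v) (g p))) (at p)"
      if "p \<in> S" for p
      by (intro bounded_bilinear.FDERIV[OF assms(1)] Ck_on_SucD(1)[OF f that] Ck_on_SucD(1)[OF g that])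
    show "Ck_on k (\<lambda>p. h (f p) (frechet_derivative g (at p) v) + h (frechet_derivative f (at p) v) (g p)) S"
      for v
      by (intro Ck_on_add[OF assms(2)] Suc.IH Ck_on_SucD(2)[OF f] Ck_on_SucD(2)[OF g]
          Ck_on_Suc_imp[OF f] Ck_on_Suc_imp[OF g])
  qed
qed

lemmas Ck_on_scaleR = Ck_on_bilinear[OF bounded_bilinear_scaleR]
lemmas Ck_on_mult = Ck_on_bilinear[OF bounded_bilinear_mult]
lemmas Ck_on_inner = Ck_on_bilinear[OF bounded_bilinear_inner]

lemma Ck_on_diff:
  assumes "open S" "Ck_on k f S" "Ck_on k g S"
  shows "Ck_on k (\<lambda>p. f p - g p) S"
  using Ck_on_add[OF assms(1,2) Ck_on_scaleR[OF assms(1) Ck_on_const[OF assms(1), of _ "-1"] assms(3)]]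
  by simp

text \<open>The derivative \<open>- (1/f) (Df) (1/f)\<close> contains no worse function than \<open>1/f\<close> itself, so the
  regularity of \<open>1/f\<close> improves step by step.\<close>
lemma Ck_on_inverse:
  fixes f :: "'a::real_normed_vector \<Rightarrow> real"
  assumes "open S" "Ck_on k f S" "\<And>p. p \<in> S \<Longrightarrow> f p \<noteq> 0"
  shows "Ck_on k (\<lambda>p. inverse (f p)) S"
  using assms(2)
proof (induction k)
  case 0
  then show ?case using assms(3) by (simp add: continuous_intros)
next
  case (Suc k)
  have IH: "Ck_on k (\<lambda>p. inverse (f p)) S"
    using Suc Ck_on_Suc_imp by blast
  show ?case
  proof (rule Ck_on_SucI[OF assms(1)])
    show "((\<lambda>p. inverse (f p)) has_derivative
        (\<lambda>v. (-1) * (inverse (f p) * frechet_derivative f (at p) v * inverse (f p)))) (at p)"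
      if "p \<in> S" for p
      using Deriv.has_derivative_inverse[OF assms(3)[OF that] Ck_on_SucD(1)[OF Suc.prems that]] by simp
    show "Ck_on k (\<lambda>p. (-1) * (inverse (f p) * frechet_derivative f (at p) v * inverse (f p))) S" for v
      by (intro Ck_on_mult Ck_on_const assms(1) IH Ck_on_SucD(2)[OF Suc.prems])
  qed
qed

text \<open>As for reciprocals, the derivative \<open>(p \<bullet> v) / |p|\<close> is expressed by the norm itself.\<close>
lemma Ck_on_norm: "Ck_on k (norm :: 'a::real_inner \<Rightarrow> real) (- {0})"
proof (induction k)
  case 0
  then show ?case by (simp add: continuous_intros)
next
  case (Suc k)
  have op: "open (- {0::'a})" by (rule open_Compl[OF closed_singleton])
  show ?case
  proof (rule Ck_on_SucI[OF op])
    show "(norm has_derivative (\<lambda>v. (p \<bullet> v) * inverse (norm p))) (at p)"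
      if "p \<in> - {0}" for p :: 'a
      using that has_derivative_norm[of p] by (simp add: sgn_div_norm inner_commute mult.commute)
    show "Ck_on k (\<lambda>p::'a. (p \<bullet> v) * inverse (norm p)) (- {0})" for v
      by (intro Ck_on_mult Ck_on_inner Ck_on_inverse op Ck_on_ident Ck_on_const Suc.IH) auto
  qed
qed

section \<open>Gradients and homogeneity\<close>

lemma inner_grad:
  fixes f :: "real^'n \<Rightarrow> real"
  assumes "(f has_derivative f') (at p)"
  shows "grad f p \<bullet> v = f' v"
proof -
  have f': "f' = frechet_derivative f (at p)" "linear f'"
    using assms frechet_derivative_at has_derivative_linear by blast+
  have "f' v = f' (\<Sum>i\<in>UNIV. v $ i *\<^sub>R axis i 1)"
    by (simp add: basis_expansion[of v, unfolded scalar_mult_eq_scaleR])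
  also have "\<dots> = (\<Sum>i\<in>UNIV. v $ i * f' (axis i 1))"
    using f'(2) by (simp add: linear_sum linear_cmul)
  finally show ?thesis
    by (simp add: grad_def f'(1)[symmetric] inner_vec_def mult.commute)
qed

lemma grad_eqI:
  fixes f :: "real^'n \<Rightarrow> real"
  assumes "(f has_derivative (\<lambda>v. g \<bullet> v)) (at p)"
  shows "grad f p = g"
  using inner_grad[OF assms] by (metis vector_eq_rdot)

lemma has_derivative_grad:
  fixes f :: "real^'n \<Rightarrow> real"
  assumes "f differentiable (at p)"
  shows "(f has_derivative (\<lambda>v. grad f p \<bullet> v)) (at p)"
  using assms inner_grad[of f _ p] by (auto simp: frechet_derivative_works)

lemma Ck_on_grad:
  fixes f :: "real^'n \<Rightarrow> real"
  assumes "open S" "Ck_on (Suc k) f S"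
  shows "Ck_on k (grad f) S"
proof -
  have eq: "(\<Sum>i\<in>UNIV. frechet_derivative f (at p) (axis i 1) *\<^sub>R axis i 1) = grad f p" for p
    using basis_expansion[of "grad f p", unfolded scalar_mult_eq_scaleR] by (simp add: grad_def)
  have "Ck_on k (\<lambda>p. \<Sum>i\<in>UNIV. frechet_derivative f (at p) (axis i 1) *\<^sub>R axis i 1) S"
    by (intro Ck_on_sum Ck_on_scaleR Ck_on_const assms(1) Ck_on_SucD(2)[OF assms(2)] finite_class.finite_UNIV)
  then show ?thesis by (rule Ck_on_cong[OF assms(1), rotated]) (rule eq)
qed

text \<open>Euler's identity: differentiate \<open>c \<mapsto> \<phi>(c p) = c \<phi>(p)\<close> at \<open>c = 1\<close>.\<close>
lemma grad_inner_self_homogeneous: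
  fixes f :: "real^'n \<Rightarrow> real"
  assumes hom: "\<And>c. c > 0 \<Longrightarrow> f (c *\<^sub>R p) = c * f p" and "f differentiable (at p)"
  shows "grad f p \<bullet> p = f p"
proof -
  have f: "(f has_derivative (\<lambda>v. grad f p \<bullet> v)) (at (1 *\<^sub>R p))"
    using has_derivative_grad[OF assms(2)] by simp
  have "((\<lambda>c::real. c *\<^sub>R p) has_derivative (\<lambda>c. c *\<^sub>R p)) (at 1)"
    by (rule has_derivative_scaleR_left[OF has_derivative_ident])
  then have "((\<lambda>c::real. f (c *\<^sub>R p)) has_derivative (\<lambda>c. grad f p \<bullet> (c *\<^sub>R p))) (at 1)"
    using f by (rule has_derivative_compose)
  moreover have "((\<lambda>c::real. c * f p) has_derivative (\<lambda>c. c * f p)) (at 1)"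
    by (rule has_derivative_mult_left[OF has_derivative_ident])
  then have "((\<lambda>c::real. f (c *\<^sub>R p)) has_derivative (\<lambda>c. c * f p)) (at 1)"
    by (rule has_derivative_transform_within_open[where s = "{0<..}"]) (auto simp: hom)
  ultimately have "(\<lambda>c. grad f p \<bullet> (c *\<^sub>R p)) = (\<lambda>c. c * f p)"
    by (rule has_derivative_unique)
  from fun_cong[OF this, of 1] show ?thesis by simp
qed

text \<open>Differentiating \<open>\<phi>(c q) = c \<phi>(q)\<close> in \<open>q\<close> produces a factor \<open>c\<close> on both sides.\<close>
lemma grad_homogeneous:
  fixes f :: "real^'n \<Rightarrow> real"
  assumes hom: "\<And>q. f (c *\<^sub>R q) = c * f q" and c: "c \<noteq> 0"
    and diff: "f differentiable (at p)" "f differentiable (at (c *\<^sub>R p))"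
  shows "grad f (c *\<^sub>R p) = grad f p"
proof -
  have "((\<lambda>q. c *\<^sub>R q) has_derivative (\<lambda>v. c *\<^sub>R v)) (at p)"
    by (rule has_derivative_scaleR_right[OF has_derivative_ident])
  then have "((\<lambda>q. f (c *\<^sub>R q)) has_derivative (\<lambda>v. grad f (c *\<^sub>R p) \<bullet> (c *\<^sub>R v))) (at p)"
    using has_derivative_grad[OF diff(2)] by (rule has_derivative_compose)
  moreover have "((\<lambda>q. f (c *\<^sub>R q)) has_derivative (\<lambda>v. c * (grad f p \<bullet> v))) (at p)"
    unfolding hom by (intro has_derivative_mult_right has_derivative_grad diff)
  ultimately have "(\<lambda>v. grad f (c *\<^sub>R p) \<bullet> (c *\<^sub>R v)) = (\<lambda>v. c * (grad f p \<bullet> v))"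
    by (rule has_derivative_unique)
  then have "grad f (c *\<^sub>R p) \<bullet> v = grad f p \<bullet> v" for v
    using c by (metis inner_scaleR_right mult_left_cancel)
  then show ?thesis by (metis vector_eq_rdot)
qed

section \<open>Anisotropy and mobility\<close>

lemma anisotropy_differentiable:
  "anisotropy \<phi> \<Longrightarrow> p \<noteq> 0 \<Longrightarrow> \<phi> differentiable (at p)"
  unfolding anisotropy_def by (auto simp: eval_nat_numeral)

lemma anisotropy_pos: "anisotropy \<phi> \<Longrightarrow> p \<noteq> 0 \<Longrightarrow> \<phi> p > 0"
  unfolding anisotropy_def by auto

lemma anisotropy_scaleR: "anisotropy \<phi> \<Longrightarrow> c > 0 \<Longrightarrow> \<phi> (c *\<^sub>R p) = c * \<phi> p"
  unfolding anisotropy_def by auto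

lemma Ck_on_grad_anisotropy: "anisotropy \<phi> \<Longrightarrow> Ck_on 3 (grad \<phi>) (- {0})"
  by (rule Ck_on_grad) (auto simp: anisotropy_def eval_nat_numeral simp del: Ck_on.simps)

lemma grad_anisotropy_inner:
  "anisotropy \<phi> \<Longrightarrow> p \<noteq> 0 \<Longrightarrow> grad \<phi> p \<bullet> p = \<phi> p"
  by (rule grad_inner_self_homogeneous) (auto simp: anisotropy_scaleR anisotropy_differentiable)

lemma grad_anisotropy_scaleR:
  "anisotropy \<phi> \<Longrightarrow> p \<noteq> 0 \<Longrightarrow> c > 0 \<Longrightarrow> grad \<phi> (c *\<^sub>R p) = grad \<phi> p"
  by (rule grad_homogeneous) (auto simp: anisotropy_scaleR anisotropy_differentiable)

lemma grad_Phi: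
  assumes "anisotropy \<phi>" "p \<noteq> 0"
  shows "grad (Phi \<phi>) p = \<phi> p *\<^sub>R grad \<phi> p"
  unfolding Phi_def[abs_def]
  by (rule grad_eqI)
     (auto intro!: derivative_eq_intros has_derivative_grad anisotropy_differentiable assms)

lemma mobility_normalized: "mobility m \<Longrightarrow> p \<noteq> 0 \<Longrightarrow> m (p /\<^sub>R norm p) = m p"
  unfolding mobility_def by auto

lemma mobility_pos: "mobility m \<Longrightarrow> p \<noteq> 0 \<Longrightarrow> m p > 0"
  using mobility_normalized[of m p] unfolding mobility_def
  by (metis norm_sgn sgn_div_norm)

lemma alpha_pos: "anisotropy \<phi> \<Longrightarrow> mobility m \<Longrightarrow> p \<noteq> 0 \<Longrightarrow> alpha \<phi> m p > 0"
  by (simp add: alpha_def mobility_pos anisotropy_pos)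

section \<open>The matrix \<open>H\<close>\<close>

lemma outer_mult_vec: "outer a b *v z = (b \<bullet> z) *\<^sub>R (a :: real^'n)"
  by (simp add: outer_def matrix_vector_mult_def inner_vec_def vec_eq_iff sum_distrib_left ac_simps)

lemma bounded_bilinear_outer: "bounded_bilinear (outer :: real^'n \<Rightarrow> real^'n \<Rightarrow> real^'n^'n)"
proof -
  have "bilinear (outer :: real^'n \<Rightarrow> real^'n \<Rightarrow> real^'n^'n)"
    unfolding bilinear_def
    by (auto intro!: linearI simp: outer_def vec_eq_iff algebra_simps)
  then show ?thesis by (simp add: bilinear_conv_bounded_bilinear)
qed

lemma wvec_eq:
  assumes "anisotropy \<phi>" "p \<noteq> 0"
  shows "wvec \<phi> p = (norm p / \<phi> p) *\<^sub>R grad \<phi> p - p /\<^sub>R norm p"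
proof -
  have "(outer p p /\<^sub>R (norm p)\<^sup>2) *v grad \<phi> p = (\<phi> p / (norm p)\<^sup>2) *\<^sub>R p"
    using grad_anisotropy_inner[OF assms]
    by (simp add: scaleR_matrix_vector_assoc[symmetric] outer_mult_vec inner_commute field_simps)
  then show ?thesis
    using anisotropy_pos[OF assms] assms(2)
    by (simp add: wvec_def matrix_vector_mult_diff_rdistrib scaleR_right_diff_distrib
        power2_eq_square field_simps)
qed

lemma wvec_orthogonal:
  assumes "anisotropy \<phi>" "p \<noteq> 0"
  shows "wvec \<phi> p \<bullet> p = 0"
  using anisotropy_pos[OF assms] grad_anisotropy_inner[OF assms] assms(2)
  by (simp add: wvec_eq[OF assms] inner_diff_left dot_square_norm power2_eq_square)

lemma Hmat_mult_vec:
  fixes \<phi> :: "real^'n \<Rightarrow> real" and p z :: "real^'n"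
  defines "w \<equiv> wvec \<phi> p" and "u \<equiv> p /\<^sub>R norm p"
  shows "Hmat \<phi> m p *v z = alpha \<phi> m p *\<^sub>R
    (z + (((u - w) \<bullet> z) *\<^sub>R w - ((w + (norm w)\<^sup>2 *\<^sub>R u) \<bullet> z) *\<^sub>R u) /\<^sub>R (1 + (norm w)\<^sup>2))"
  unfolding Hmat_def Let_def w_def u_def
  by (simp add: scaleR_matrix_vector_assoc[symmetric] matrix_vector_mult_add_rdistrib
      matrix_vector_mult_diff_rdistrib outer_mult_vec)

text \<open>With respect to the splitting of space into \<open>p\<close>'s orthogonal complement and the line
  spanned by \<open>u + w\<close>, which is the direction of \<open>\<phi>'(p)\<close>, the first component of \<open>H(p)z\<close> is a
  multiple of the normal projection of \<open>z\<close>.\<close>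
lemma Hmat_mult_vec_split:
  fixes \<phi> :: "real^'n \<Rightarrow> real" and p z :: "real^'n"
  defines "w \<equiv> wvec \<phi> p" and "u \<equiv> p /\<^sub>R norm p"
  shows "Hmat \<phi> m p *v z = alpha \<phi> m p *\<^sub>R
    ((z - (u \<bullet> z) *\<^sub>R u) + ((u \<bullet> z - w \<bullet> z) / (1 + (norm w)\<^sup>2)) *\<^sub>R (u + w))"
proof -
  define D where "D = 1 + (norm w)\<^sup>2"
  have D: "D > 0" and n: "(norm w)\<^sup>2 = D - 1"
    by (auto simp: D_def add_pos_nonneg)
  have "z + ((u \<bullet> z - w \<bullet> z) *\<^sub>R w - (w \<bullet> z + (D - 1) * (u \<bullet> z)) *\<^sub>R u) /\<^sub>R D
      = (z - (u \<bullet> z) *\<^sub>R u) + ((u \<bullet> z - w \<bullet> z) / D) *\<^sub>R (u + w)"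
    using D by (simp add: vec_eq_iff field_simps)
  then show ?thesis
    using Hmat_mult_vec[of \<phi> m p z, folded w_def u_def]
    by (simp add: n inner_diff_left inner_add_left)
qed

lemma Hmat_coercive:
  fixes p z :: "real^'n"
  assumes "anisotropy \<phi>" "mobility m" "p \<noteq> 0"
  shows "(Hmat \<phi> m p *v z) \<bullet> z \<ge> alpha \<phi> m p / (1 + (norm (wvec \<phi> p))\<^sup>2) * (norm z)\<^sup>2"
proof -
  define w u where "w = wvec \<phi> p" and "u = p /\<^sub>R norm p"
  define a b D where "a = u \<bullet> z" and "b = w \<bullet> z" and "D = 1 + (norm w)\<^sup>2"
  have uu: "u \<bullet> u = 1" and wu: "w \<bullet> u = 0"
    using assms wvec_orthogonal[of \<phi> p] by (auto simp: u_def w_def dot_square_norm power2_eq_square)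
  have D: "D > 0" and n: "(norm w)\<^sup>2 = D - 1"
    by (auto simp: D_def add_pos_nonneg)
  \<comment> \<open>Since \<open>w \<bottom> u\<close>, Cauchy--Schwarz may be applied to the part of \<open>z\<close> normal to \<open>u\<close>.\<close>
  have "(w \<bullet> (z - a *\<^sub>R u))\<^sup>2 \<le> (w \<bullet> w) * ((z - a *\<^sub>R u) \<bullet> (z - a *\<^sub>R u))"
    by (rule Cauchy_Schwarz_ineq)
  moreover have "w \<bullet> (z - a *\<^sub>R u) = b"
    by (simp add: inner_diff_right wu b_def)
  moreover have "(z - a *\<^sub>R u) \<bullet> (z - a *\<^sub>R u) = (norm z)\<^sup>2 - a\<^sup>2"
    by (simp add: inner_diff_left inner_diff_right uu a_def inner_commute[of z u]
        power2_norm_eq_inner power2_eq_square[of "_ \<bullet> _"])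
  moreover have "w \<bullet> w = D - 1"
    by (simp add: D_def power2_norm_eq_inner)
  ultimately have CS: "b\<^sup>2 \<le> (D - 1) * ((norm z)\<^sup>2 - a\<^sup>2)" by simp
  have "(Hmat \<phi> m p *v z) \<bullet> z
      = alpha \<phi> m p * ((norm z)\<^sup>2 - a\<^sup>2 + (a - b) / D * (a + b))"
    by (simp add: Hmat_mult_vec_split[of \<phi> m p z, folded w_def u_def] inner_add_left inner_diff_left
        a_def[symmetric] b_def[symmetric] D_def[symmetric] dot_square_norm power2_eq_square[of a])
  also have "(norm z)\<^sup>2 - a\<^sup>2 + (a - b) / D * (a + b)
      = (norm z)\<^sup>2 / D + ((D - 1) * ((norm z)\<^sup>2 - a\<^sup>2) - b\<^sup>2) / D"
    using D by (simp add: field_simps power2_eq_square)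
  finally have eq: "(Hmat \<phi> m p *v z) \<bullet> z
      = alpha \<phi> m p * ((norm z)\<^sup>2 / D + ((D - 1) * ((norm z)\<^sup>2 - a\<^sup>2) - b\<^sup>2) / D)" .
  have "(norm z)\<^sup>2 / D \<le> (norm z)\<^sup>2 / D + ((D - 1) * ((norm z)\<^sup>2 - a\<^sup>2) - b\<^sup>2) / D"
    using CS D by simp
  from mult_left_mono[OF this less_imp_le[OF alpha_pos[OF assms]]] show ?thesis
    unfolding eq by (simp add: D_def w_def)
qed

lemma Hmat_pos_definite:
  assumes "anisotropy \<phi>" "mobility m" "p \<noteq> 0"
  shows "pos_definite (Hmat \<phi> m p)"
  unfolding pos_definite_def
proof (intro allI impI)
  fix z :: "real^'a" assume "z \<noteq> 0"
  then have "0 < alpha \<phi> m p / (1 + (norm (wvec \<phi> p))\<^sup>2) * (norm z)\<^sup>2"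
    using alpha_pos[OF assms] by (intro mult_pos_pos divide_pos_pos add_pos_nonneg) auto
  also have "\<dots> \<le> (Hmat \<phi> m p *v z) \<bullet> z"
    by (rule Hmat_coercive[OF assms])
  finally show "0 < (Hmat \<phi> m p *v z) \<bullet> z" .
qed

lemma Ck_on_Hmat:
  fixes \<phi> m :: "real^'n \<Rightarrow> real"
  assumes "anisotropy \<phi>" "mobility m"
  shows "Ck_on 3 (Hmat \<phi> m) (- {0})"
proof -
  let ?S = "- {0 :: real^'n}"
  have op: "open ?S" by (rule open_Compl[OF closed_singleton])
  have phi: "Ck_on 3 \<phi> ?S"
    using assms(1) by (intro Ck_on_Suc_imp[of 3]) (simp add: anisotropy_def eval_nat_numeral del: Ck_on.simps)
  have m: "Ck_on 3 m ?S"
    using assms(2) by (simp add: mobility_def)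
  have u: "Ck_on 3 (\<lambda>p. p /\<^sub>R norm p) ?S"
    by (intro Ck_on_scaleR Ck_on_inverse Ck_on_norm Ck_on_ident op) auto
  have "Ck_on 3 (\<lambda>p. (norm p * inverse (\<phi> p)) *\<^sub>R grad \<phi> p - p /\<^sub>R norm p) ?S"
    using anisotropy_pos[OF assms(1)]
    by (intro Ck_on_diff Ck_on_scaleR[of _ _ "\<lambda>p. norm p * inverse (\<phi> p)"] Ck_on_mult
        Ck_on_inverse Ck_on_norm phi u op Ck_on_grad_anisotropy[OF assms(1)]) force+
  then have w: "Ck_on 3 (wvec \<phi>) ?S"
    by (rule Ck_on_cong[OF op, rotated]) (simp add: wvec_eq[OF assms(1)] divide_inverse)
  have ww: "Ck_on 3 (\<lambda>p. wvec \<phi> p \<bullet> wvec \<phi> p) ?S"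
    by (intro Ck_on_inner op w)
  have "1 + x \<bullet> x \<noteq> 0" for x :: "real^'n"
    using inner_ge_zero[of x] by linarith
  then have inv: "Ck_on 3 (\<lambda>p. inverse (1 + wvec \<phi> p \<bullet> wvec \<phi> p)) ?S"
    by (intro Ck_on_inverse Ck_on_add Ck_on_const ww op)
  have al: "Ck_on 3 (alpha \<phi> m) ?S"
    unfolding alpha_def[abs_def] by (intro Ck_on_mult m phi Ck_on_norm op)
  note outer = Ck_on_bilinear[OF bounded_bilinear_outer op]
  show ?thesis
    unfolding Hmat_def[abs_def] Let_def power2_norm_eq_inner
    by (intro Ck_on_scaleR[OF op al] Ck_on_add[OF op] Ck_on_const[OF op] Ck_on_scaleR[OF op inv]
        Ck_on_diff[OF op] outer w u Ck_on_scaleR[OF op ww])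
qed

section \<open>From the system to anisotropic curve shortening flow\<close>

text \<open>The algebraic core: with \<open>g\<close> in the role of \<open>[\<phi>'(x\<^sub>\<rho>)]\<^sub>\<rho>\<close> and \<open>s\<close> in that of
  \<open>[\<phi>(x\<^sub>\<rho>)]\<^sub>\<rho>\<close>, both sides of the system are split into a vector normal to \<open>p\<close> and a multiple
  of \<open>\<phi>'(p)\<close>, and such a splitting is unique because \<open>\<phi>'(p) \<bullet> p \<noteq> 0\<close>.\<close>
lemma Hmat_system_normal_part:
  fixes p v g :: "real^'n"
  assumes an: "anisotropy \<phi>" and p: "p \<noteq> 0" and g: "g \<bullet> p = 0"
    and eq: "Hmat \<phi> m p *v v = s *\<^sub>R grad \<phi> p + \<phi> p *\<^sub>R g"
  defines "u \<equiv> p /\<^sub>R norm p"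
  shows "(m p * norm p) *\<^sub>R (v - (u \<bullet> v) *\<^sub>R u) = g"
proof -
  define w where "w = wvec \<phi> p"
  have uu: "u \<bullet> u = 1" and wu: "w \<bullet> u = 0" and gu: "g \<bullet> u = 0"
    using p g wvec_orthogonal[OF an p] by (auto simp: u_def w_def dot_square_norm power2_eq_square)
  have phi: "\<phi> p > 0" using an p by (rule anisotropy_pos)
  have gr: "grad \<phi> p = (\<phi> p / norm p) *\<^sub>R (u + w)"
    using phi p by (simp add: w_def wvec_eq[OF an p] u_def)
  define c where "c = alpha \<phi> m p * ((u \<bullet> v - w \<bullet> v) / (1 + (norm w)\<^sup>2))"
  define c' where "c' = s * (\<phi> p / norm p)"
  let ?n = "v - (u \<bullet> v) *\<^sub>R u"
  have split: "alpha \<phi> m p *\<^sub>R ?n + c *\<^sub>R (u + w) = \<phi> p *\<^sub>R g + c' *\<^sub>R (u + w)"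
    using eq unfolding gr Hmat_mult_vec_split w_def[symmetric] u_def[symmetric] c_def c'_def
    by (simp only: scaleR_add_right scaleR_scaleR add_ac)
  have "(alpha \<phi> m p *\<^sub>R ?n + c *\<^sub>R (u + w)) \<bullet> u = c"
    by (simp add: inner_add_left inner_diff_left uu wu inner_commute[of v u])
  moreover have "(\<phi> p *\<^sub>R g + c' *\<^sub>R (u + w)) \<bullet> u = c'"
    by (simp add: inner_add_left uu wu gu)
  ultimately have "c = c'" using split by metis
  with split have "\<phi> p *\<^sub>R ((m p * norm p) *\<^sub>R ?n) = \<phi> p *\<^sub>R g"
    by (simp add: alpha_def mult.commute mult.assoc)
  with phi show ?thesis by (metis scaleR_cancel_left less_irrefl)
qed

text \<open>The orthogonality \<open>g \<bullet> y(\<rho>) = 0\<close> amounts to \<open>\<phi>''(p)p = 0\<close> and the symmetry of the Hessian.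
  Differentiating Euler's identity along the curve instead of in space gives it from first
  derivatives of \<open>\<phi>'\<close> alone, with no appeal to the symmetry.\<close>
lemma vector_derivative_grad_curve:
  fixes y :: "real \<Rightarrow> real^'n"
  assumes an: "anisotropy \<phi>" and y0: "\<And>r. y r \<noteq> 0" and y: "(y has_vector_derivative y') (at \<rho>)"
  obtains g where "((\<lambda>r. grad \<phi> (y r)) has_vector_derivative g) (at \<rho>)"
    and "g \<bullet> y \<rho> = 0"
    and "((\<lambda>r. grad (Phi \<phi>) (y r)) has_vector_derivative
           ((grad \<phi> (y \<rho>) \<bullet> y') *\<^sub>R grad \<phi> (y \<rho>) + \<phi> (y \<rho>) *\<^sub>R g)) (at \<rho>)"
proof -
  have "grad \<phi> differentiable (at (y \<rho>))"
    using Ck_on_grad_anisotropy[OF an] y0 by (simp add: eval_nat_numeral)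
  moreover have "y differentiable (at \<rho>)"
    using y by (rule differentiableI_vector)
  ultimately have "(\<lambda>r. grad \<phi> (y r)) differentiable (at \<rho>)"
    by (rule differentiable_compose)
  then obtain g where g: "((\<lambda>r. grad \<phi> (y r)) has_vector_derivative g) (at \<rho>)"
    by (rule that[OF vector_derivative_works[THEN iffD1]])
  have phi: "((\<lambda>r. \<phi> (y r)) has_vector_derivative (grad \<phi> (y \<rho>) \<bullet> y')) (at \<rho>)"
    using has_derivative_compose[OF y[unfolded has_vector_derivative_def]
        has_derivative_grad[OF anisotropy_differentiable[OF an y0[of \<rho>]]]]
    by (simp add: has_vector_derivative_def)
  have "((\<lambda>r. grad \<phi> (y r) \<bullet> y r) has_vector_derivative (grad \<phi> (y \<rho>) \<bullet> y' + g \<bullet> y \<rho>)) (at \<rho>)"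
    by (rule bounded_bilinear.has_vector_derivative[OF bounded_bilinear_inner g y])
  \<comment> \<open>By Euler's identity the function just differentiated is \<open>\<phi> \<circ> y\<close>.\<close>
  then have "grad \<phi> (y \<rho>) \<bullet> y' + g \<bullet> y \<rho> = grad \<phi> (y \<rho>) \<bullet> y'"
    unfolding grad_anisotropy_inner[OF an y0] by (rule vector_derivative_unique_at[OF _ phi])
  then have gy: "g \<bullet> y \<rho> = 0" by simp
  have "((\<lambda>r. \<phi> (y r) *\<^sub>R grad \<phi> (y r)) has_vector_derivative
      (\<phi> (y \<rho>) *\<^sub>R g + (grad \<phi> (y \<rho>) \<bullet> y') *\<^sub>R grad \<phi> (y \<rho>))) (at \<rho>)"
    by (rule bounded_bilinear.has_vector_derivative[OF bounded_bilinear_scaleR phi g])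
  then have "((\<lambda>r. grad (Phi \<phi>) (y r)) has_vector_derivative
      ((grad \<phi> (y \<rho>) \<bullet> y') *\<^sub>R grad \<phi> (y \<rho>) + \<phi> (y \<rho>) *\<^sub>R g)) (at \<rho>)"
    by (simp add: grad_Phi[OF an y0] add.commute)
  with g gy show ?thesis by (rule that)
qed

lemma solves_H_system_imp_ACSF:
  assumes an: "anisotropy \<phi>" and mob: "mobility m" and sol: "solves_H_system \<phi> m T x"
  shows "solves_ACSF \<phi> m T x"
proof -
  have cl: "classical_curve T x" "immersed T x"
    using sol by (auto simp: solves_H_system_def)
  have "(\<lambda>r. grad \<phi> (tangent x r t)) differentiable (at \<rho>) \<and>
      m (tangent x \<rho> t) *\<^sub>R
          ((mat 1 - outer (tangent x \<rho> t) (tangent x \<rho> t)) *v d_time T x \<rho> t) =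
        d_rho (\<lambda>r s. grad \<phi> (tangent x r s)) \<rho> t /\<^sub>R norm (d_rho x \<rho> t)"
    if t: "t \<in> {0<..T}" for \<rho> t
  proof -
    define y where "y = (\<lambda>r. d_rho x r t)"
    define v where "v = d_time T x \<rho> t"
    have y0: "y r \<noteq> 0" for r
      using cl(2) t by (auto simp: immersed_def y_def)
    have "(y has_vector_derivative vector_derivative y (at \<rho>)) (at \<rho>)"
      using cl(1) t unfolding classical_curve_def y_def vector_derivative_works[symmetric] by blast
    then obtain g where g: "((\<lambda>r. grad \<phi> (y r)) has_vector_derivative g) (at \<rho>)" "g \<bullet> y \<rho> = 0"
      and G: "((\<lambda>r. grad (Phi \<phi>) (y r)) has_vector_derivative
           ((grad \<phi> (y \<rho>) \<bullet> vector_derivative y (at \<rho>)) *\<^sub>R grad \<phi> (y \<rho>) + \<phi> (y \<rho>) *\<^sub>R g)) (at \<rho>)"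
      by (rule vector_derivative_grad_curve[where y = y, OF an y0])
    have "Hmat \<phi> m (y \<rho>) *v v = vector_derivative (\<lambda>r. grad (Phi \<phi>) (y r)) (at \<rho>)"
      using sol t by (auto simp: solves_H_system_def d_rho_def y_def v_def)
    then have normal: "(m (y \<rho>) * norm (y \<rho>)) *\<^sub>R
        (v - ((y \<rho> /\<^sub>R norm (y \<rho>)) \<bullet> v) *\<^sub>R (y \<rho> /\<^sub>R norm (y \<rho>))) = g"
      unfolding vector_derivative_at[OF G]
      by (rule Hmat_system_normal_part[OF an y0 g(2)])
    have tau: "tangent x r t = y r /\<^sub>R norm (y r)" for r
      by (simp add: tangent_def y_def)
    have same: "(\<lambda>r. grad \<phi> (tangent x r t)) = (\<lambda>r. grad \<phi> (y r))"
      using y0 by (simp add: tau grad_anisotropy_scaleR[OF an])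
    have "(\<lambda>r. grad \<phi> (tangent x r t)) differentiable (at \<rho>)"
      unfolding same using g(1) by (rule differentiableI_vector)
    moreover have "d_rho (\<lambda>r s. grad \<phi> (tangent x r s)) \<rho> t = g"
      unfolding d_rho_def same using g(1) by (rule vector_derivative_at)
    moreover have "m (y \<rho>) *\<^sub>R ((mat 1 - outer (tangent x \<rho> t) (tangent x \<rho> t)) *v v)
        = g /\<^sub>R norm (y \<rho>)"
      unfolding tau normal[symmetric] using y0[of \<rho>]
      by (simp add: matrix_vector_mult_diff_rdistrib outer_mult_vec)
    moreover have "m (tangent x \<rho> t) = m (y \<rho>)"
      unfolding tau by (rule mobility_normalized[OF mob y0])
    ultimately show ?thesis
      by (simp add: v_def y_def)
  qed
  with cl show ?thesis by (simp add: solves_ACSF_def)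
qed

theorem theorem2p3:
  fixes \<phi> m :: "real^'n \<Rightarrow> real"
  assumes "CARD('n) \<ge> 2"
    and "anisotropy \<phi>"
    and "mobility m"
  shows "(\<forall>p. p \<noteq> 0 \<longrightarrow> alpha \<phi> m p > 0 \<and>
            wvec \<phi> p = (norm p / \<phi> p) *\<^sub>R grad \<phi> p - p /\<^sub>R norm p) \<and>
    (\<forall>T x. T > 0 \<and> solves_H_system \<phi> m T x \<longrightarrow> solves_ACSF \<phi> m T x) \<and>
    Ck_on 3 (Hmat \<phi> m) (- {0}) \<and>
    (\<forall>p. p \<noteq> 0 \<longrightarrow> pos_definite (Hmat \<phi> m p) \<and>
      (\<forall>z. (Hmat \<phi> m p *v z) \<bullet> z \<ge> alpha \<phi> m p / (1 + (norm (wvec \<phi> p))\<^sup>2) * (norm z)\<^sup>2))"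
  using alpha_pos[OF assms(2,3)] wvec_eq[OF assms(2)] solves_H_system_imp_ACSF[OF assms(2,3)]
    Ck_on_Hmat[OF assms(2,3)] Hmat_pos_definite[OF assms(2,3)] Hmat_coercive[OF assms(2,3)]
  by blast

end
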